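(* There exists an absolute constant $c>0$ such that for every integer $n\ge 1$ and all $p=(p_1,\dots,p_n),\,q=(q_1,\dots,q_n)\in[0,1]^n$, \[ c\,\mathbb E\min\{1,\sqrt G\}\;\le\; d_{\mathrm{TV}}\bigl(\mathrm{Ber}(p),\mathrm{Ber}(q)\bigr)\;\le\;\mathbb E\min\{1,\sqrt G\}, \] where $G=\sum_{i=1}^n a_i^2 D_i$, with $D_1,\dots,D_n$ independent, $D_i\sim\mathrm{Ber}(\lambda_i)$, $\lambda_i=p_i(1-q_i)+(1-p_i)q_i$, and $a_i=|p_i-q_i|/\lambda_i$ if $\lambda_i>0$, $a_i=0$ if $\lambda_i=0$.
   Context: For probability measures $\mu,\nu$ on a finite set, $d_{\mathrm{TV}}(\mu,\nu)=\frac12\sum_x|\mu(x)-\nu(x)|$. For $s\in[0,1]$, $\mathrm{Ber}(s)$ is the Bernoulli law on $\{0,1\}$ giving mass $s$ to $1$ and $1-s$ to $0$. For a vector $p=(p_1,\dots,p_n)\in[0,1]^n$, $\mathrm{Ber}(p)=\bigotimes_{i=1}^n\mathrm{Ber}(p_i)$ is the product measure on $\{0,1\}^n$. The constant $c$ does not depend on $n$, $p$ or $q$. *)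

theory Defs
  imports "HOL-Probability.Probability"
begin

text \<open>
  Vectors of length \<open>n\<close> are functions on \<open>nat\<close> of which only the values at the indices
  \<open>i < n\<close> matter, and the bits 1 and 0 are \<open>True\<close> and \<open>False\<close>. A point of the cube is
  represented by the function that is \<open>False\<close> at all indices \<open>i \<ge> n\<close>.
\<close>

definition cube :: "nat \<Rightarrow> (nat \<Rightarrow> bool) set" where
  "cube n = PiE_dflt {..<n} False (\<lambda>_. UNIV)"

definition Ber :: "nat \<Rightarrow> (nat \<Rightarrow> real) \<Rightarrow> (nat \<Rightarrow> bool) pmf" where
  "Ber n p = Pi_pmf {..<n} False (\<lambda>i. bernoulli_pmf (p i))"

text \<open>
  The first argument is the finite ground set carrying both measures; it is needed because
  the type \<open>nat \<Rightarrow> bool\<close> is infinite.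
\<close>

definition tv_dist :: "'a set \<Rightarrow> 'a pmf \<Rightarrow> 'a pmf \<Rightarrow> real" where
  "tv_dist \<Omega> \<mu> \<nu> = 1 / 2 * (\<Sum>x\<in>\<Omega>. \<bar>pmf \<mu> x - pmf \<nu> x\<bar>)"

definition lam :: "(nat \<Rightarrow> real) \<Rightarrow> (nat \<Rightarrow> real) \<Rightarrow> nat \<Rightarrow> real" where
  "lam p q i = p i * (1 - q i) + (1 - p i) * q i"

definition coef :: "(nat \<Rightarrow> real) \<Rightarrow> (nat \<Rightarrow> real) \<Rightarrow> nat \<Rightarrow> real" where
  "coef p q i = (if lam p q i > 0 then \<bar>p i - q i\<bar> / lam p q i else 0)"

definition G :: "nat \<Rightarrow> (nat \<Rightarrow> real) \<Rightarrow> (nat \<Rightarrow> real) \<Rightarrow> (nat \<Rightarrow> bool) \<Rightarrow> real" where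
  "G n p q D = (\<Sum>i<n. (coef p q i)\<^sup>2 * of_bool (D i))"

text \<open>
  The joint law of independent \<open>D i\<close> with law \<open>Ber (lam p q i)\<close> is the product measure
  \<open>Ber n (lam p q)\<close>, so the expectation is taken over the coordinates under that measure.
\<close>

definition E_min_sqrt_G :: "nat \<Rightarrow> (nat \<Rightarrow> real) \<Rightarrow> (nat \<Rightarrow> real) \<Rightarrow> real" where
  "E_min_sqrt_G n p q =
     measure_pmf.expectation (Ber n (lam p q)) (\<lambda>D. min 1 (sqrt (G n p q D)))"

end

theory Submission
  imports Defs
begin

text \<open>
  Compare the pairs \<open>(X, Y) \<sim> P \<otimes> Q\<close> and \<open>(X, Y) \<sim> Q \<otimes> P\<close>, where \<open>P = Ber(p)\<close> and \<open>Q = Ber(q)\<close>;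
  their total variation distance lies between \<open>d\<close> and \<open>2 d\<close> for \<open>d = d\<^sub>T\<^sub>V(P, Q)\<close>. The vector
  \<open>D = X xor Y\<close> has law \<open>Ber(\<lambda>)\<close> in both cases. Given \<open>D\<close>, the coordinates with \<open>D\<^sub>i = 0\<close> have
  the same law in both cases, while those with \<open>D\<^sub>i = 1\<close> are independent biased signs with biases
  \<open>\<plusminus>(p\<^sub>i - q\<^sub>i) / \<lambda>\<^sub>i\<close>. So it suffices to bound the distance of two product laws of signs with
  opposite biases \<open>\<plusminus>b\<^sub>i\<close> above and below in terms of \<open>min(1, \<sigma>)\<close>, \<open>\<sigma>\<^sup>2 = \<Sum>b\<^sub>i\<^sup>2\<close>. The upper bound and
  the lower bound for \<open>\<sigma>\<^sup>2 \<ge> 1/6\<close> come from the Hellinger affinity \<open>\<Prod>\<surd>(1 - b\<^sub>i\<^sup>2)\<close>. For small \<open>\<sigma>\<close>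
  the density difference \<open>W = \<Prod>(1 + b\<^sub>i\<epsilon>\<^sub>i) - \<Prod>(1 - b\<^sub>i\<epsilon>\<^sub>i)\<close> has second moment at least \<open>4 \<sigma>\<^sup>2\<close> and
  fourth moment of order \<open>\<sigma>\<^sup>4\<close>, which forces its first moment to be of order \<open>\<sigma>\<close>.
\<close>

section \<open>Sums over the cube\<close>

lemma finite_cube: "finite (cube n)"
  unfolding cube_def by (intro finite_PiE_dflt) auto

lemma sum_prod_cube:
  fixes f :: "nat \<Rightarrow> bool \<Rightarrow> real"
  shows "(\<Sum>x\<in>cube n. \<Prod>i<n. f i (x i)) = (\<Prod>i<n. f i True + f i False)"
proof -
  have "(\<Prod>i<n. f i True + f i False) = (\<Prod>i<n. \<Sum>e\<in>UNIV. f i e)"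
    by (simp add: UNIV_bool add.commute)
  also have "\<dots> = (\<Sum>x\<in>PiE {..<n} (\<lambda>_. UNIV). \<Prod>i<n. f i (x i))"
    by (rule prod_sum_PiE) auto
  \<comment> \<open>Functions in \<open>PiE\<close> are \<open>undefined\<close> off
    \<open>{..<n}\<close>, points of \<open>cube\<close> are \<open>False\<close> there; changing
    the default is injective and leaves the product unchanged.\<close>
  also have "\<dots> = (\<Sum>x\<in>cube n. \<Prod>i<n. f i (x i))"
    unfolding cube_def dflt_image_PiE [symmetric]
  proof (subst sum.reindex)
    show "inj_on (\<lambda>h i. if i \<in> {..<n} then h i else False) (PiE {..<n} (\<lambda>_. UNIV))"
      unfolding inj_on_def fun_eq_iff by (metis PiE_arb)
  qed simp
  finally show ?thesis by simp
qed

text \<open>Xor with a fixed \<open>x\<close> is an involution of the cube. This is the change of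
  variables from pairs \<open>(x, y)\<close> to \<open>x\<close> and the xor vector
  \<open>D\<close>.\<close>

lemma sum_cube_xor:
  fixes g :: "(nat \<Rightarrow> bool) \<Rightarrow> real"
  assumes "x \<in> cube n"
  shows "(\<Sum>y\<in>cube n. g y) = (\<Sum>D\<in>cube n. g (\<lambda>i. x i \<noteq> D i))"
proof (rule sum.reindex_bij_witness[of _ "\<lambda>D i. x i \<noteq> D i" "\<lambda>D i. x i \<noteq> D i"])
  have xor_xor: "(\<lambda>i. x i \<noteq> (x i \<noteq> y i)) = y" for y by auto
  show "(\<lambda>i. x i \<noteq> (x i \<noteq> y i)) = y" "(\<lambda>i. x i \<noteq> (x i \<noteq> y i)) = y"
    "g (\<lambda>i. x i \<noteq> (x i \<noteq> y i)) = g y" for y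
    unfolding xor_xor by (rule refl)+
qed (use assms in \<open>auto simp: cube_def PiE_dflt_def\<close>)

section \<open>Elementary inequalities for products and moments\<close>

text \<open>When both products are expanded, terms of even degree cancel and those of odd degree
  double; only degree 1 is kept.\<close>

lemma prod_one_add_diff_ge:
  fixes f :: "'a \<Rightarrow> real"
  assumes "finite I" "\<And>i. i \<in> I \<Longrightarrow> 0 \<le> f i"
  shows "(\<Prod>i\<in>I. 1 + f i) - (\<Prod>i\<in>I. 1 - f i) \<ge> 2 * (\<Sum>i\<in>I. f i)"
proof -
  \<comment> \<open>The bound on the sum of the products is carried along because a new factor adds
    \<open>f j * (P + M)\<close> to their difference.\<close>
  have "(\<Prod>i\<in>I. 1 + f i) + (\<Prod>i\<in>I. 1 - f i) \<ge> 2 \<and>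
        (\<Prod>i\<in>I. 1 + f i) - (\<Prod>i\<in>I. 1 - f i) \<ge> 2 * (\<Sum>i\<in>I. f i)"
    using assms
  proof (induction I rule: finite_induct)
    case (insert j I)
    define P where "P = (\<Prod>i\<in>I. 1 + f i)"
    define M where "M = (\<Prod>i\<in>I. 1 - f i)"
    define s where "s = (\<Sum>i\<in>I. f i)"
    have IH: "P + M \<ge> 2" "P - M \<ge> 2 * s"
      using insert by (auto simp: P_def M_def s_def)
    have pos: "0 \<le> f j" "0 \<le> s" using insert by (auto simp: s_def intro: sum_nonneg)
    have "f j * (P - M) \<ge> 0" using pos IH by (intro mult_nonneg_nonneg) auto
    moreover have "f j * (P + M) \<ge> f j * 2" using pos IH by (intro mult_left_mono) auto
    ultimately have "(1 + f j) * P + (1 - f j) * M \<ge> 2"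
      "(1 + f j) * P - (1 - f j) * M \<ge> 2 * (f j + s)"
      using IH by (auto simp: algebra_simps)
    then show ?case using insert.hyps by (simp add: P_def M_def s_def)
  qed auto
  then show ?thesis by simp
qed

lemma sqrt_prod: "sqrt (\<Prod>i\<in>I. f i) = (\<Prod>i\<in>I. sqrt (f i))"
  by (induction I rule: infinite_finite_induct) (auto simp: real_sqrt_mult)

lemma prod_le_exp_sum_of_le:
  fixes f g :: "'a \<Rightarrow> real"
  assumes "finite I" "\<And>i. i \<in> I \<Longrightarrow> 0 \<le> f i" "\<And>i. i \<in> I \<Longrightarrow> f i \<le> exp (g i)"
  shows "(\<Prod>i\<in>I. f i) \<le> exp (\<Sum>i\<in>I. g i)"
  unfolding exp_sum[OF assms(1)] using assms by (intro prod_mono) auto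

lemma sum_squares_le_square_sum:
  fixes f :: "'a \<Rightarrow> real"
  assumes "finite I" "\<And>i. i \<in> I \<Longrightarrow> 0 \<le> f i"
  shows "(\<Sum>i\<in>I. (f i)\<^sup>2) \<le> (\<Sum>i\<in>I. f i)\<^sup>2"
  using assms
proof (induction I rule: finite_induct)
  case (insert j I)
  have "0 \<le> f j * (\<Sum>i\<in>I. f i)" using insert by (intro mult_nonneg_nonneg sum_nonneg) auto
  then show ?case using insert by (simp add: power2_sum)
qed auto

text \<open>
  With \<open>x\<^sub>i = b\<^sub>i\<^sup>2\<close> the left-hand side is the fourth moment of \<open>W\<close>: its summands are the expectations of the
  terms of the binomial expansion. The terms of order 0 and 1 in \<open>s\<close> cancel.
\<close>

lemma fourth_moment_bound:
  fixes x :: "'a \<Rightarrow> real"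
  assumes "finite I" "\<And>i. i \<in> I \<Longrightarrow> 0 \<le> x i \<and> x i \<le> 1" and s: "s = (\<Sum>i\<in>I. x i)" "s \<le> 1 / 6"
  shows "2 * (\<Prod>i\<in>I. 1 + 6 * x i + (x i)\<^sup>2) - 8 * (\<Prod>i\<in>I. 1 - (x i)\<^sup>2)
           + 6 * (\<Prod>i\<in>I. (1 - x i)\<^sup>2) \<le> 104 * s\<^sup>2"
proof -
  have s0: "0 \<le> s" using assms by (auto intro: sum_nonneg)
  have "(\<Prod>i\<in>I. 1 + 6 * x i + (x i)\<^sup>2) \<le> exp (\<Sum>i\<in>I. 6 * x i)"
  proof (intro prod_le_exp_sum_of_le)
    fix i assume i: "i \<in> I"
    show "0 \<le> 1 + 6 * x i + (x i)\<^sup>2" using assms(2)[OF i] by simp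
    have "1 + 6 * x i + (x i)\<^sup>2 \<le> (1 + 3 * x i)\<^sup>2" by (simp add: power2_eq_square algebra_simps)
    also have "\<dots> \<le> (exp (3 * x i))\<^sup>2"
      using assms(2)[OF i] by (intro power_mono exp_ge_add_one_self) auto
    also have "\<dots> = exp (6 * x i)" by (simp flip: exp_double)
    finally show "1 + 6 * x i + (x i)\<^sup>2 \<le> exp (6 * x i)" .
  qed fact
  also have "(\<Sum>i\<in>I. 6 * x i) = 6 * s" by (simp add: s sum_distrib_left)
  \<comment> \<open>The quadratic bound on \<open>exp\<close> needs \<open>6 * s\<close> to be at
    most 1, whence the threshold 1/6.\<close>
  also have "exp (6 * s) \<le> 1 + 6 * s + (6 * s)\<^sup>2" using s0 s by (intro exp_bound) auto
  finally have 1: "(\<Prod>i\<in>I. 1 + 6 * x i + (x i)\<^sup>2) \<le> 1 + 6 * s + 36 * s\<^sup>2"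
    by (simp add: power_mult_distrib)
  have "1 - s\<^sup>2 \<le> 1 - (\<Sum>i\<in>I. (x i)\<^sup>2)"
    using sum_squares_le_square_sum[of I x] assms by simp
  also have "\<dots> \<le> (\<Prod>i\<in>I. 1 - (x i)\<^sup>2)"
    using assms by (intro Weierstrass_prod_ineq) (auto simp: power_le_one)
  finally have 2: "1 - s\<^sup>2 \<le> (\<Prod>i\<in>I. 1 - (x i)\<^sup>2)" .
  have "(\<Prod>i\<in>I. (1 - x i)\<^sup>2) \<le> exp (\<Sum>i\<in>I. - 2 * x i)"
  proof (intro prod_le_exp_sum_of_le)
    fix i assume i: "i \<in> I"
    have "(1 - x i)\<^sup>2 \<le> (exp (- x i))\<^sup>2"
      using assms(2)[OF i] exp_ge_add_one_self[of "- x i"] by (intro power_mono) auto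
    then show "(1 - x i)\<^sup>2 \<le> exp (- 2 * x i)"
      by (simp add: exp_double[symmetric])
  qed (use assms in auto)
  also have "(\<Sum>i\<in>I. - 2 * x i) = - (2 * s)" by (simp add: s sum_distrib_left sum_negf)
  also have "exp (- (2 * s)) \<le> 1 / (1 + 2 * s)"
    using exp_ge_add_one_self[of "2 * s"] s0 by (simp add: exp_minus field_simps)
  also have "\<dots> \<le> 1 - 2 * s + 4 * s\<^sup>2"
  proof -
    have "1 \<le> (1 - 2 * s + 4 * s\<^sup>2) * (1 + 2 * s)"
      using s0 by (simp add: algebra_simps power2_eq_square)
    then show ?thesis using s0 by (simp add: divide_le_eq)
  qed
  finally have 3: "(\<Prod>i\<in>I. (1 - x i)\<^sup>2) \<le> 1 - 2 * s + 4 * s\<^sup>2" .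
  \<comment> \<open>The coefficients of \<open>s\<^sup>2\<close> add up to 2 * 36 + 8 + 6 * 4 =
    104.\<close>
  show ?thesis using 1 2 3 by linarith
qed

text \<open>Summed against a measure, this bounds the first absolute moment from below by the second
  and fourth moments. The free \<open>t\<close> is later matched to the scale of
  \<open>w\<close>.\<close>

lemma abs_ge_quadratic_sub_quartic:
  fixes t w :: real
  assumes "0 < t"
  shows "\<bar>w\<bar> \<ge> t * w\<^sup>2 - t ^ 3 * w ^ 4"
proof -
  define y where "y = t * \<bar>w\<bar>"
  have y: "0 \<le> y" using assms by (simp add: y_def)
  have "y * (1 - y + y ^ 3) \<ge> 0"
  proof (intro mult_nonneg_nonneg y)
    show "1 - y + y ^ 3 \<ge> 0"
    proof (cases "y \<le> 1")
      case False
      then have "y ^ 1 \<le> y ^ 3" by (intro power_increasing) auto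
      then show ?thesis by simp
    qed (use y in simp)
  qed
  then have "y - y\<^sup>2 + y ^ 4 \<ge> 0" by (simp add: algebra_simps power2_eq_square eval_nat_numeral)
  moreover have "y - y\<^sup>2 + y ^ 4 = t * (\<bar>w\<bar> - t * w\<^sup>2 + t ^ 3 * w ^ 4)"
    by (simp add: y_def power_mult_distrib algebra_simps power2_eq_square eval_nat_numeral)
  ultimately have "\<bar>w\<bar> - t * w\<^sup>2 + t ^ 3 * w ^ 4 \<ge> 0"
    using assms by (simp add: zero_le_mult_iff)
  then show ?thesis by simp
qed

section \<open>Distance between two oppositely tilted product measures\<close>

text \<open>
  The signs enter through two measures with densities \<open>\<Prod>(1 \<plusminus> \<beta>\<^sub>i)\<close> with respect to \<open>\<Prod>m\<^sub>i\<close>, which need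
  not be normalised. Coordinates with \<open>D\<^sub>i = 0\<close> have \<open>\<beta>\<^sub>i = 0\<close>, so that no restriction to a subset of
  the coordinates is needed.
\<close>

locale balanced_tilt =
  fixes n :: nat and m \<beta> :: "nat \<Rightarrow> bool \<Rightarrow> real" and a :: "nat \<Rightarrow> real"
  assumes weight_nonneg: "i < n \<Longrightarrow> 0 \<le> m i e"
    and abs_tilt: "i < n \<Longrightarrow> \<bar>\<beta> i e\<bar> = a i"
    and tilt_le_one: "i < n \<Longrightarrow> a i \<le> 1"
    and balanced: "i < n \<Longrightarrow> m i True * \<beta> i True + m i False * \<beta> i False = 0"
begin

definition "M x = (\<Prod>i<n. m i (x i))"
definition "A x = (\<Prod>i<n. 1 + \<beta> i (x i))"
definition "B x = (\<Prod>i<n. 1 - \<beta> i (x i))"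
definition "mass = (\<Prod>i<n. m i True + m i False)"
definition "s = (\<Sum>i<n. (a i)\<^sup>2)"
text \<open>The Hellinger affinity of the two measures is \<open>mass * \<rho>\<close>.\<close>

definition "\<rho> = (\<Prod>i<n. sqrt (1 - (a i)\<^sup>2))"

lemma tilt_nonneg: "i < n \<Longrightarrow> 0 \<le> a i"
  using abs_tilt[of i True] by simp

lemma tilt_sq: "i < n \<Longrightarrow> (\<beta> i e)\<^sup>2 = (a i)\<^sup>2"
  using abs_tilt[of i e] by (metis power2_abs)

lemma tilt_sq_le_one: "i < n \<Longrightarrow> (a i)\<^sup>2 \<le> 1"
  using tilt_nonneg tilt_le_one by (simp add: power_le_one)

lemma abs_tilt_le_one: "i < n \<Longrightarrow> \<bar>\<beta> i e\<bar> \<le> 1"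
  using abs_tilt tilt_le_one by simp

lemma M_nonneg: "0 \<le> M x"
  unfolding M_def using weight_nonneg by (intro prod_nonneg) auto

lemma A_nonneg: "0 \<le> A x"
  unfolding A_def
proof (rule prod_nonneg)
  show "0 \<le> 1 + \<beta> i (x i)" if "i \<in> {..<n}" for i
    using abs_tilt_le_one[of i "x i"] that by simp
qed

lemma B_nonneg: "0 \<le> B x"
  unfolding B_def
proof (rule prod_nonneg)
  show "0 \<le> 1 - \<beta> i (x i)" if "i \<in> {..<n}" for i
    using abs_tilt_le_one[of i "x i"] that by simp
qed

lemma mass_nonneg: "0 \<le> mass"
  unfolding mass_def using weight_nonneg by (intro prod_nonneg) auto

lemma s_nonneg: "0 \<le> s"
  unfolding s_def by (intro sum_nonneg) auto

text \<open>
  On \<open>\<plusminus>a\<^sub>i\<close> every function \<open>h\<close> is affine, and by balance its linear part integrates to 0.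
\<close>

lemma sum_tilt_product:
  assumes "\<And>i b. b\<^sup>2 = (a i)\<^sup>2 \<Longrightarrow> h b = g i + k i * b"
  shows "(\<Sum>x\<in>cube n. M x * (\<Prod>i<n. h (\<beta> i (x i)))) = mass * (\<Prod>i<n. g i)"
proof -
  have "(\<Sum>x\<in>cube n. M x * (\<Prod>i<n. h (\<beta> i (x i)))) =
        (\<Prod>i<n. m i True * h (\<beta> i True) + m i False * h (\<beta> i False))"
    unfolding M_def prod.distrib[symmetric] by (rule sum_prod_cube)
  also have "\<dots> = (\<Prod>i<n. (m i True + m i False) * g i)"
  proof (intro prod.cong refl)
    fix i assume "i \<in> {..<n}"
    then have i: "i < n" by simp
    have "m i True * h (\<beta> i True) + m i False * h (\<beta> i False) =
          (m i True + m i False) * g i + k i * (m i True * \<beta> i True + m i False * \<beta> i False)"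
      by (simp add: assms[OF tilt_sq[OF i]] algebra_simps)
    then show "m i True * h (\<beta> i True) + m i False * h (\<beta> i False) = (m i True + m i False) * g i"
      by (simp add: balanced[OF i])
  qed
  finally show ?thesis by (simp add: mass_def prod.distrib)
qed

lemma sum_A: "(\<Sum>x\<in>cube n. M x * A x) = mass"
  unfolding A_def using sum_tilt_product[of "\<lambda>b. 1 + b" "\<lambda>_. 1" "\<lambda>_. 1"] by simp

lemma sum_B: "(\<Sum>x\<in>cube n. M x * B x) = mass"
  unfolding B_def using sum_tilt_product[of "\<lambda>b. 1 - b" "\<lambda>_. 1" "\<lambda>_. - 1"] by simp

lemma sum_sqrt_AB: "(\<Sum>x\<in>cube n. M x * (sqrt (A x) * sqrt (B x))) = mass * \<rho>"
proof -
  have "sqrt (A x) * sqrt (B x) = (\<Prod>i<n. sqrt (1 - (\<beta> i (x i))\<^sup>2))" for x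
    unfolding A_def B_def real_sqrt_mult[symmetric] prod.distrib[symmetric] sqrt_prod
    by (simp add: algebra_simps power2_eq_square)
  then show ?thesis
    unfolding \<rho>_def
    using sum_tilt_product[of "\<lambda>b. sqrt (1 - b\<^sup>2)" "\<lambda>i. sqrt (1 - (a i)\<^sup>2)" "\<lambda>_. 0"]
    by simp
qed

lemma rho_nonneg: "0 \<le> \<rho>"
  unfolding \<rho>_def using tilt_sq_le_one by (intro prod_nonneg) auto

lemma rho_sq_ge: "1 - s \<le> \<rho>\<^sup>2"
proof -
  have "1 - s \<le> (\<Prod>i<n. 1 - (a i)\<^sup>2)"
    unfolding s_def using tilt_sq_le_one by (intro Weierstrass_prod_ineq) auto
  also have "\<dots> = \<rho>\<^sup>2"
    unfolding \<rho>_def prod_power_distrib using tilt_sq_le_one by (intro prod.cong) auto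
  finally show ?thesis .
qed

lemma rho_le: "\<rho> \<le> exp (- s / 2)"
proof -
  have "\<rho> \<le> exp (\<Sum>i<n. - ((a i)\<^sup>2 / 2))"
    unfolding \<rho>_def
  proof (rule prod_le_exp_sum_of_le)
    fix i assume "i \<in> {..<n}"
    then have le: "(a i)\<^sup>2 \<le> 1" using tilt_sq_le_one by simp
    then show "0 \<le> sqrt (1 - (a i)\<^sup>2)" by simp
    have "1 - (a i)\<^sup>2 \<le> exp (- (a i)\<^sup>2)" using exp_ge_add_one_self[of "- (a i)\<^sup>2"] by simp
    also have "\<dots> = (exp (- ((a i)\<^sup>2 / 2)))\<^sup>2" by (simp flip: exp_double)
    finally show "sqrt (1 - (a i)\<^sup>2) \<le> exp (- ((a i)\<^sup>2 / 2))"
      by (intro real_le_lsqrt) auto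
  qed simp
  also have "(\<Sum>i<n. - ((a i)\<^sup>2 / 2)) = - s / 2"
    by (simp add: s_def sum_negf sum_divide_distrib)
  finally show ?thesis .
qed

lemma sum_sqrt_diff_sq: "(\<Sum>x\<in>cube n. M x * (sqrt (A x) - sqrt (B x))\<^sup>2) = 2 * mass * (1 - \<rho>)"
proof -
  have "M x * (sqrt (A x) - sqrt (B x))\<^sup>2 =
        M x * A x + M x * B x - 2 * (M x * (sqrt (A x) * sqrt (B x)))" for x
    using A_nonneg[of x] B_nonneg[of x] by (simp add: power2_diff algebra_simps)
  then show ?thesis
    by (simp only: sum.distrib sum_subtractf sum_distrib_left[symmetric] sum_A sum_B sum_sqrt_AB)
       (simp add: algebra_simps)
qed

lemma sum_sqrt_add_sq: "(\<Sum>x\<in>cube n. M x * (sqrt (A x) + sqrt (B x))\<^sup>2) = 2 * mass * (1 + \<rho>)"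
proof -
  have "M x * (sqrt (A x) + sqrt (B x))\<^sup>2 =
        M x * A x + M x * B x + 2 * (M x * (sqrt (A x) * sqrt (B x)))" for x
    using A_nonneg[of x] B_nonneg[of x] by (simp add: power2_sum algebra_simps)
  then show ?thesis
    by (simp only: sum.distrib sum_distrib_left[symmetric] sum_A sum_B sum_sqrt_AB)
       (simp add: algebra_simps)
qed

lemma abs_diff_AB: "\<bar>A x - B x\<bar> = \<bar>sqrt (A x) - sqrt (B x)\<bar> * (sqrt (A x) + sqrt (B x))"
proof -
  have "A x - B x = (sqrt (A x) - sqrt (B x)) * (sqrt (A x) + sqrt (B x))"
    using A_nonneg[of x] B_nonneg[of x] by (simp add: algebra_simps)
  then show ?thesis
    using A_nonneg[of x] B_nonneg[of x] by (metis abs_mult abs_of_nonneg add_nonneg_nonneg real_sqrt_ge_zero)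
qed

text \<open>The bound with 1 is the triangle inequality. For the other, Cauchy-Schwarz applied to
  the factorisation of \<open>A x - B x\<close> through square roots gives
  \<open>(2 * mass)\<^sup>2 * (1 - \<rho>\<^sup>2)\<close> for the square of the sum.\<close>

lemma sum_abs_diff_le: "(\<Sum>x\<in>cube n. M x * \<bar>A x - B x\<bar>) \<le> 2 * mass * min 1 (sqrt s)"
proof -
  define T where "T = (\<Sum>x\<in>cube n. M x * \<bar>A x - B x\<bar>)"
  have "T \<le> (\<Sum>x\<in>cube n. M x * A x + M x * B x)"
    unfolding T_def
  proof (rule sum_mono)
    fix x
    have "\<bar>A x - B x\<bar> \<le> A x + B x" using A_nonneg[of x] B_nonneg[of x] by linarith
    then show "M x * \<bar>A x - B x\<bar> \<le> M x * A x + M x * B x"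
      using M_nonneg[of x] by (simp add: mult_left_mono flip: distrib_left)
  qed
  then have 1: "T \<le> 2 * mass" by (simp add: sum.distrib sum_A sum_B)
  have T: "T = (\<Sum>x\<in>cube n. (sqrt (M x) * \<bar>sqrt (A x) - sqrt (B x)\<bar>)
                              * (sqrt (M x) * (sqrt (A x) + sqrt (B x))))"
    unfolding T_def abs_diff_AB
  proof (intro sum.cong refl)
    fix x
    have "sqrt (M x) * sqrt (M x) = M x" using M_nonneg[of x] by simp
    then show "M x * (\<bar>sqrt (A x) - sqrt (B x)\<bar> * (sqrt (A x) + sqrt (B x))) =
      (sqrt (M x) * \<bar>sqrt (A x) - sqrt (B x)\<bar>) * (sqrt (M x) * (sqrt (A x) + sqrt (B x)))"
      by (metis mult.assoc mult.left_commute)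
  qed
  have "T\<^sup>2 \<le> (\<Sum>x\<in>cube n. (sqrt (M x) * \<bar>sqrt (A x) - sqrt (B x)\<bar>)\<^sup>2)
                       * (\<Sum>x\<in>cube n. (sqrt (M x) * (sqrt (A x) + sqrt (B x)))\<^sup>2)"
    unfolding T by (rule Cauchy_Schwarz_ineq_sum)
  also have "\<dots> = (2 * mass * (1 - \<rho>)) * (2 * mass * (1 + \<rho>))"
    by (simp add: power_mult_distrib M_nonneg sum_sqrt_diff_sq sum_sqrt_add_sq)
  also have "\<dots> = (2 * mass)\<^sup>2 * (1 - \<rho>\<^sup>2)" by (simp add: power2_eq_square algebra_simps)
  also have "\<dots> \<le> (2 * mass)\<^sup>2 * s" using rho_sq_ge by (intro mult_left_mono) auto
  also have "\<dots> = (2 * mass * sqrt s)\<^sup>2" using s_nonneg by (simp add: power_mult_distrib)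
  finally have "T \<le> 2 * mass * sqrt s"
    using mass_nonneg s_nonneg by (intro power2_le_imp_le[where x = T]) auto
  with 1 show ?thesis unfolding T_def by (simp add: min_def)
qed

text \<open>Pointwise, the squared difference of the square roots is at most
  \<open>\<bar>A x - B x\<bar>\<close>, and it sums to
  \<open>2 * mass * (1 - \<rho>)\<close>.\<close>

lemma sum_abs_diff_ge_hellinger: "(\<Sum>x\<in>cube n. M x * \<bar>A x - B x\<bar>) \<ge> 2 * mass * (1 - exp (- s / 2))"
proof -
  have "2 * mass * (1 - exp (- s / 2)) \<le> 2 * mass * (1 - \<rho>)"
    using rho_le mass_nonneg by (intro mult_left_mono) auto
  also have "\<dots> \<le> (\<Sum>x\<in>cube n. M x * \<bar>A x - B x\<bar>)"
    unfolding sum_sqrt_diff_sq[symmetric]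
  proof (intro sum_mono mult_left_mono M_nonneg)
    fix x
    have "\<bar>sqrt (A x) - sqrt (B x)\<bar> * \<bar>sqrt (A x) - sqrt (B x)\<bar>
            \<le> \<bar>sqrt (A x) - sqrt (B x)\<bar> * (sqrt (A x) + sqrt (B x))"
      using A_nonneg[of x] B_nonneg[of x] by (intro mult_left_mono) (auto simp: abs_le_iff)
    then show "(sqrt (A x) - sqrt (B x))\<^sup>2 \<le> \<bar>A x - B x\<bar>"
      unfolding abs_diff_AB by (simp add: power2_eq_square)
  qed
  finally show ?thesis .
qed

section \<open>Second and fourth moments of the density difference\<close>

lemma sum_diff_sq_ge: "(\<Sum>x\<in>cube n. M x * (A x - B x)\<^sup>2) \<ge> 4 * mass * s"
proof -
  have AA: "(\<Sum>x\<in>cube n. M x * (A x)\<^sup>2) = mass * (\<Prod>i<n. 1 + (a i)\<^sup>2)"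
    unfolding A_def prod_power_distrib
    by (rule sum_tilt_product[of "\<lambda>b. (1 + b)\<^sup>2" _ "\<lambda>_. 2"]) (simp add: power2_sum)
  have BB: "(\<Sum>x\<in>cube n. M x * (B x)\<^sup>2) = mass * (\<Prod>i<n. 1 + (a i)\<^sup>2)"
    unfolding B_def prod_power_distrib
    by (rule sum_tilt_product[of "\<lambda>b. (1 - b)\<^sup>2" _ "\<lambda>_. - 2"]) (simp add: power2_diff)
  \<comment> \<open>Here \<open>erule subst\<close> turns \<open>(a i)\<^sup>2\<close> into
    \<open>b\<^sup>2\<close>, which leaves a polynomial identity in \<open>b\<close>.\<close>
  have AB: "(\<Sum>x\<in>cube n. M x * (A x * B x)) = mass * (\<Prod>i<n. 1 - (a i)\<^sup>2)"
    unfolding A_def B_def prod.distrib[symmetric]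
    by (rule sum_tilt_product[of "\<lambda>b. (1 + b) * (1 - b)" _ "\<lambda>_. 0"])
       (erule subst, simp add: power2_eq_square algebra_simps)
  have "M x * (A x - B x)\<^sup>2 = M x * (A x)\<^sup>2 + M x * (B x)\<^sup>2 - 2 * (M x * (A x * B x))" for x
    by (simp add: power2_diff algebra_simps)
  then have "(\<Sum>x\<in>cube n. M x * (A x - B x)\<^sup>2) =
      2 * mass * ((\<Prod>i<n. 1 + (a i)\<^sup>2) - (\<Prod>i<n. 1 - (a i)\<^sup>2))"
    by (simp only: sum.distrib sum_subtractf sum_distrib_left[symmetric] AA BB AB)
       (simp add: algebra_simps)
  also have "\<dots> \<ge> 2 * mass * (2 * s)"
    unfolding s_def using mass_nonneg
    by (intro mult_left_mono prod_one_add_diff_ge) auto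
  finally show ?thesis by simp
qed

lemma sum_diff_fourth_le:
  assumes "s \<le> 1 / 6"
  shows "(\<Sum>x\<in>cube n. M x * (A x - B x) ^ 4) \<le> 104 * mass * s\<^sup>2"
proof -
  \<comment> \<open>In each mixed moment the even part of the polynomial in \<open>b\<close> becomes
    the factor on the right; the odd part divided by \<open>b\<close> is the supplied linear
    coefficient.\<close>
  have A4: "(\<Sum>x\<in>cube n. M x * (A x) ^ 4) = mass * (\<Prod>i<n. 1 + 6 * (a i)\<^sup>2 + ((a i)\<^sup>2)\<^sup>2)"
    unfolding A_def prod_power_distrib
    by (rule sum_tilt_product[of "\<lambda>b. (1 + b) ^ 4" _ "\<lambda>i. 4 + 4 * (a i)\<^sup>2"])
       (erule subst, simp add: eval_nat_numeral algebra_simps)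
  have B4: "(\<Sum>x\<in>cube n. M x * (B x) ^ 4) = mass * (\<Prod>i<n. 1 + 6 * (a i)\<^sup>2 + ((a i)\<^sup>2)\<^sup>2)"
    unfolding B_def prod_power_distrib
    by (rule sum_tilt_product[of "\<lambda>b. (1 - b) ^ 4" _ "\<lambda>i. - (4 + 4 * (a i)\<^sup>2)"])
       (erule subst, simp add: eval_nat_numeral algebra_simps)
  have A3B: "(\<Sum>x\<in>cube n. M x * (A x ^ 3 * B x)) = mass * (\<Prod>i<n. 1 - ((a i)\<^sup>2)\<^sup>2)"
    unfolding A_def B_def prod_power_distrib prod.distrib[symmetric]
    by (rule sum_tilt_product[of "\<lambda>b. (1 + b) ^ 3 * (1 - b)" _ "\<lambda>i. 2 - 2 * (a i)\<^sup>2"])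
       (erule subst, simp add: eval_nat_numeral algebra_simps)
  have AB3: "(\<Sum>x\<in>cube n. M x * (A x * B x ^ 3)) = mass * (\<Prod>i<n. 1 - ((a i)\<^sup>2)\<^sup>2)"
    unfolding A_def B_def prod_power_distrib prod.distrib[symmetric]
    by (rule sum_tilt_product[of "\<lambda>b. (1 + b) * (1 - b) ^ 3" _ "\<lambda>i. - (2 - 2 * (a i)\<^sup>2)"])
       (erule subst, simp add: eval_nat_numeral algebra_simps)
  have A2B2: "(\<Sum>x\<in>cube n. M x * ((A x)\<^sup>2 * (B x)\<^sup>2)) = mass * (\<Prod>i<n. (1 - (a i)\<^sup>2)\<^sup>2)"
    unfolding A_def B_def prod_power_distrib prod.distrib[symmetric]
    by (rule sum_tilt_product[of "\<lambda>b. (1 + b)\<^sup>2 * (1 - b)\<^sup>2" _ "\<lambda>_. 0"])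
       (erule subst, simp add: eval_nat_numeral algebra_simps)
  have "M x * (A x - B x) ^ 4 = M x * (A x) ^ 4 - 4 * (M x * (A x ^ 3 * B x))
          + 6 * (M x * ((A x)\<^sup>2 * (B x)\<^sup>2)) - 4 * (M x * (A x * B x ^ 3)) + M x * (B x) ^ 4" for x
    by (simp add: eval_nat_numeral algebra_simps)
  then have "(\<Sum>x\<in>cube n. M x * (A x - B x) ^ 4) =
      mass * (2 * (\<Prod>i<n. 1 + 6 * (a i)\<^sup>2 + ((a i)\<^sup>2)\<^sup>2) - 8 * (\<Prod>i<n. 1 - ((a i)\<^sup>2)\<^sup>2)
              + 6 * (\<Prod>i<n. (1 - (a i)\<^sup>2)\<^sup>2))"
    by (simp only: sum.distrib sum_subtractf sum_distrib_left[symmetric] A4 B4 A3B AB3 A2B2)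
       (simp add: algebra_simps)
  also have "\<dots> \<le> mass * (104 * s\<^sup>2)"
    using mass_nonneg assms tilt_sq_le_one s_def
    by (intro mult_left_mono fourth_moment_bound) auto
  finally show ?thesis by simp
qed

lemma sum_abs_diff_ge: "(\<Sum>x\<in>cube n. M x * \<bar>A x - B x\<bar>) \<ge> 2 / 13 * mass * min 1 (sqrt s)"
proof (cases "s \<le> 1 / 6")
  case True
  show ?thesis
  proof (cases "s = 0")
    case True
    then show ?thesis using M_nonneg by (auto intro!: sum_nonneg)
  next
    case False
    with s_nonneg have s: "0 < s" by simp
    define t where "t = 1 / (8 * sqrt s)" \<comment> \<open>makes the quadratic term dominate the quartic one\<close>
    have t: "0 < t" using s by (simp add: t_def)
    have ss: "sqrt s * sqrt s = s" using s by simp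
    have t1: "t * s = sqrt s / 8" using s ss by (simp add: t_def field_simps)
    have t3: "t ^ 3 * s\<^sup>2 = sqrt s / 512"
    proof -
      have "t ^ 3 * s\<^sup>2 = (t * s) * (t * sqrt s)\<^sup>2"
        using ss by (simp add: power2_eq_square eval_nat_numeral)
      then show ?thesis using t1 s by (simp add: t_def power2_eq_square)
    qed
    have "t * (4 * mass * s) - t ^ 3 * (104 * mass * s\<^sup>2) = mass * (4 * (t * s) - 104 * (t ^ 3 * s\<^sup>2))"
      by (simp add: algebra_simps)
    also have "\<dots> = 19 / 64 * (mass * sqrt s)" by (simp only: t1 t3) (simp add: field_simps)
    finally have "19 / 64 * (mass * sqrt s) = t * (4 * mass * s) - t ^ 3 * (104 * mass * s\<^sup>2)" ..
    also have "\<dots> \<le> t * (\<Sum>x\<in>cube n. M x * (A x - B x)\<^sup>2) - t ^ 3 * (\<Sum>x\<in>cube n. M x * (A x - B x) ^ 4)"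
      using t sum_diff_sq_ge sum_diff_fourth_le[OF True] by (intro diff_mono mult_left_mono) auto
    also have "\<dots> = (\<Sum>x\<in>cube n. M x * (t * (A x - B x)\<^sup>2 - t ^ 3 * (A x - B x) ^ 4))"
      by (simp add: sum_distrib_left right_diff_distrib mult.left_commute flip: sum_subtractf)
    also have "\<dots> \<le> (\<Sum>x\<in>cube n. M x * \<bar>A x - B x\<bar>)"
      by (intro sum_mono mult_left_mono abs_ge_quadratic_sub_quartic t M_nonneg)
    finally have "(\<Sum>x\<in>cube n. M x * \<bar>A x - B x\<bar>) \<ge> 19 / 64 * (mass * sqrt s)" .
    moreover have "mass * min 1 (sqrt s) \<le> mass * sqrt s" "0 \<le> mass * sqrt s"
      using mass_nonneg s by (auto intro: mult_left_mono)
    ultimately show ?thesis by simp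
  qed
next
  case False
  \<comment> \<open>For \<open>s\<close> above 1/6 the Hellinger bound retains at least 1 - 12/13 =
    1/13. With its factor 2 this determines the constant 2/13, as the small case gives the larger
    19/64.\<close>
  have "13 / 12 \<le> exp (1 / 12 :: real)" using exp_ge_add_one_self[of "1 / 12 :: real"] by simp
  then have "exp (- (1 / 12) :: real) \<le> 12 / 13" by (simp add: exp_minus field_simps)
  moreover have "exp (- s / 2) \<le> exp (- (1 / 12))" using False by simp
  ultimately have "1 / 13 \<le> 1 - exp (- s / 2)" by linarith
  then have "mass * min 1 (sqrt s) * (1 / 13) \<le> mass * 1 * (1 - exp (- s / 2))"
    using mass_nonneg s_nonneg by (intro mult_mono mult_left_mono) auto
  then show ?thesis using sum_abs_diff_ge_hellinger by simp
qed

end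

section \<open>Bernoulli product laws and swapped pairs\<close>

lemma pmf_Ber:
  assumes "x \<in> cube n"
  shows "pmf (Ber n p) x = (\<Prod>i<n. pmf (bernoulli_pmf (p i)) (x i))"
  unfolding Ber_def using assms by (subst pmf_Pi') (auto simp: cube_def PiE_dflt_def)

lemma set_pmf_Ber_subset: "set_pmf (Ber n p) \<subseteq> cube n"
  unfolding Ber_def cube_def using set_Pi_pmf_subset[of "{..<n}" False] by (auto simp: PiE_dflt_def)

lemma sum_pmf_Ber: "(\<Sum>x\<in>cube n. pmf (Ber n p) x) = 1"
  using set_pmf_Ber_subset finite_cube by (rule sum_pmf_eq_1[rotated])

lemma E_min_sqrt_G_eq_sum:
  "E_min_sqrt_G n p q = (\<Sum>D\<in>cube n. pmf (Ber n (lam p q)) D * min 1 (sqrt (G n p q D)))"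
  unfolding E_min_sqrt_G_def using set_pmf_Ber_subset finite_cube
  by (subst integral_measure_pmf[of "cube n"]) auto

text \<open>Passing to the first marginal does not increase the distance: summing the signed
  difference over \<open>y\<close> leaves \<open>pmf \<mu> x - pmf \<nu> x\<close>.\<close>

lemma tv_dist_le_swapped:
  assumes "(\<Sum>x\<in>\<Omega>. pmf \<mu> x) = 1" "(\<Sum>x\<in>\<Omega>. pmf \<nu> x) = 1"
  shows "2 * tv_dist \<Omega> \<mu> \<nu> \<le> (\<Sum>x\<in>\<Omega>. \<Sum>y\<in>\<Omega>. \<bar>pmf \<mu> x * pmf \<nu> y - pmf \<nu> x * pmf \<mu> y\<bar>)"
proof -
  have "2 * tv_dist \<Omega> \<mu> \<nu> = (\<Sum>x\<in>\<Omega>. \<bar>\<Sum>y\<in>\<Omega>. pmf \<mu> x * pmf \<nu> y - pmf \<nu> x * pmf \<mu> y\<bar>)"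
    by (simp add: tv_dist_def sum_subtractf assms flip: sum_distrib_left)
  also have "\<dots> \<le> (\<Sum>x\<in>\<Omega>. \<Sum>y\<in>\<Omega>. \<bar>pmf \<mu> x * pmf \<nu> y - pmf \<nu> x * pmf \<mu> y\<bar>)"
    by (intro sum_mono sum_abs)
  finally show ?thesis .
qed

text \<open>Insert the product of \<open>\<nu>\<close> with itself as an intermediate measure and
  change one factor at a time; each change costs \<open>2 * tv_dist\<close>.\<close>

lemma swapped_le_tv_dist:
  assumes "(\<Sum>x\<in>\<Omega>. pmf \<mu> x) = 1" "(\<Sum>x\<in>\<Omega>. pmf \<nu> x) = 1"
  shows "(\<Sum>x\<in>\<Omega>. \<Sum>y\<in>\<Omega>. \<bar>pmf \<mu> x * pmf \<nu> y - pmf \<nu> x * pmf \<mu> y\<bar>) \<le> 4 * tv_dist \<Omega> \<mu> \<nu>"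
proof -
  have "(\<Sum>x\<in>\<Omega>. \<Sum>y\<in>\<Omega>. \<bar>pmf \<mu> x * pmf \<nu> y - pmf \<nu> x * pmf \<mu> y\<bar>)
        \<le> (\<Sum>x\<in>\<Omega>. \<Sum>y\<in>\<Omega>. \<bar>pmf \<mu> x - pmf \<nu> x\<bar> * pmf \<nu> y + pmf \<nu> x * \<bar>pmf \<mu> y - pmf \<nu> y\<bar>)"
  proof (intro sum_mono)
    fix x y
    have "pmf \<mu> x * pmf \<nu> y - pmf \<nu> x * pmf \<mu> y
            = (pmf \<mu> x - pmf \<nu> x) * pmf \<nu> y + pmf \<nu> x * (pmf \<nu> y - pmf \<mu> y)"
      by (simp add: algebra_simps)
    also have "\<bar>\<dots>\<bar> \<le> \<bar>pmf \<mu> x - pmf \<nu> x\<bar> * pmf \<nu> y + pmf \<nu> x * \<bar>pmf \<mu> y - pmf \<nu> y\<bar>"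
      by (rule order.trans[OF abs_triangle_ineq]) (simp add: abs_mult abs_minus_commute)
    finally show "\<bar>pmf \<mu> x * pmf \<nu> y - pmf \<nu> x * pmf \<mu> y\<bar>
      \<le> \<bar>pmf \<mu> x - pmf \<nu> x\<bar> * pmf \<nu> y + pmf \<nu> x * \<bar>pmf \<mu> y - pmf \<nu> y\<bar>" .
  qed
  also have "\<dots> = 4 * tv_dist \<Omega> \<mu> \<nu>"
    by (simp add: tv_dist_def sum.distrib assms flip: sum_distrib_left sum_distrib_right)
  finally show ?thesis .
qed

text \<open>Both sides are built from \<open>p i * (1 - q i)\<close> and
  \<open>(1 - p i) * q i\<close>, as difference and as sum. This keeps the biases at most 1 and
  forces \<open>p i = q i\<close> when \<open>lam p q i = 0\<close>.\<close>

lemma abs_diff_le_lam: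
  assumes "p i \<in> {0..1}" "q i \<in> {0..1}"
  shows "\<bar>p i - q i\<bar> \<le> lam p q i"
proof -
  have "0 \<le> p i * (1 - q i)" "0 \<le> (1 - p i) * q i" using assms by auto
  then show ?thesis by (simp add: lam_def abs_le_iff algebra_simps)
qed

lemma lam_le_one:
  assumes "p i \<in> {0..1}" "q i \<in> {0..1}"
  shows "lam p q i \<le> 1"
proof -
  have "0 \<le> p i * q i" "0 \<le> (1 - p i) * (1 - q i)" using assms by auto
  then show ?thesis by (simp add: lam_def algebra_simps)
qed

section \<open>Fixing the xor vector\<close>

text \<open>The part of the swapped-pair distance with xor vector \<open>D\<close> is an instance of
  the tilted measures, with \<open>mass\<close> the probability of \<open>D\<close> and
  \<open>s\<close> the value of \<open>G\<close> at \<open>D\<close>.\<close>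

lemma sum_xor_bounds:
  fixes p q :: "nat \<Rightarrow> real" and D :: "nat \<Rightarrow> bool"
  assumes pq: "\<And>i. i < n \<Longrightarrow> p i \<in> {0..1} \<and> q i \<in> {0..1}" and D: "D \<in> cube n"
  defines "S \<equiv> (\<Sum>x\<in>cube n. \<bar>pmf (Ber n p) x * pmf (Ber n q) (\<lambda>i. x i \<noteq> D i)
                              - pmf (Ber n q) x * pmf (Ber n p) (\<lambda>i. x i \<noteq> D i)\<bar>)"
  shows "S \<le> 2 * pmf (Ber n (lam p q)) D * min 1 (sqrt (G n p q D))"
    and "2 / 13 * pmf (Ber n (lam p q)) D * min 1 (sqrt (G n p q D)) \<le> S"
proof -
  let ?b = "\<lambda>s. pmf (bernoulli_pmf s)"
  \<comment> \<open>Where \<open>D i\<close> holds, \<open>m\<close> is the average of the two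
    swapped products and the tilt is their relative deviation from it; elsewhere the products agree
    and the tilt is 0.\<close>
  define m where "m i e = (if D i then lam p q i / 2 else ?b (p i) e * ?b (q i) e)" for i e
  \<comment> \<open>Division by zero makes \<open>r i\<close> vanish when
    \<open>lam p q i = 0\<close>, in agreement with \<open>coef\<close>.\<close>
  define r where "r i = (p i - q i) / lam p q i" for i
  define \<beta> where "\<beta> i e = (if D i then if e then r i else - r i else 0)" for i e
  define a where "a i = coef p q i * of_bool (D i)" for i
  have lam_bounds: "0 \<le> lam p q i" "lam p q i \<le> 1" "\<bar>p i - q i\<bar> \<le> lam p q i" if "i < n" for i
    using abs_diff_le_lam[of p i q] lam_le_one[of p i q] pq[OF that] by auto
  interpret balanced_tilt n m \<beta> a
  proof
    fix i e assume i: "i < n"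
    show "0 \<le> m i e" using lam_bounds[OF i] by (simp add: m_def)
    show "\<bar>\<beta> i e\<bar> = a i"
      using lam_bounds[OF i] by (auto simp: \<beta>_def r_def a_def coef_def)
    show "a i \<le> 1" using lam_bounds[OF i] by (auto simp: a_def coef_def)
    show "m i True * \<beta> i True + m i False * \<beta> i False = 0"
      by (simp add: m_def \<beta>_def)
  qed
  have factors: "?b (p i) e * ?b (q i) (e \<noteq> D i) = m i e * (1 + \<beta> i e)"
    "?b (q i) e * ?b (p i) (e \<noteq> D i) = m i e * (1 - \<beta> i e)" if i: "i < n" for i e
  proof -
    have "p i - q i = 0" if "lam p q i = 0" using lam_bounds(3)[OF i] that by simp
    then have r: "lam p q i * r i = p i - q i" by (simp add: r_def)
    have "lam p q i * (1 + r i) = 2 * (p i * (1 - q i))" "lam p q i * (1 - r i) = 2 * ((1 - p i) * q i)"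
      unfolding distrib_left[of "lam p q i"] right_diff_distrib[of "lam p q i"] r
      by (simp_all add: lam_def algebra_simps)
    then have half: "lam p q i / 2 * (1 + r i) = p i * (1 - q i)" "lam p q i / 2 * (1 - r i) = (1 - p i) * q i"
      by (simp_all only: times_divide_eq_left)
    have b: "?b (p i) b = (if b then p i else 1 - p i)" "?b (q i) b = (if b then q i else 1 - q i)" for b
      using pq[OF i] by (cases b; simp)+
    show "?b (p i) e * ?b (q i) (e \<noteq> D i) = m i e * (1 + \<beta> i e)"
      "?b (q i) e * ?b (p i) (e \<noteq> D i) = m i e * (1 - \<beta> i e)"
      by (cases e; cases "D i"; simp only: m_def \<beta>_def b half if_True if_False simp_thms
            add_uminus_conv_diff diff_minus_eq_add mult.commute[of "q i"] mult.commute[of "1 - q i"]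
            add_0_right diff_zero mult_1_right)+
  qed
  have "S = (\<Sum>x\<in>cube n. M x * \<bar>A x - B x\<bar>)"
    unfolding S_def
  proof (intro sum.cong refl)
    fix x assume x: "x \<in> cube n"
    then have xD: "(\<lambda>i. x i \<noteq> D i) \<in> cube n" using D by (auto simp: cube_def PiE_dflt_def)
    have "pmf (Ber n p) x * pmf (Ber n q) (\<lambda>i. x i \<noteq> D i) = M x * A x"
      "pmf (Ber n q) x * pmf (Ber n p) (\<lambda>i. x i \<noteq> D i) = M x * B x"
      unfolding pmf_Ber[OF x] pmf_Ber[OF xD] M_def A_def B_def prod.distrib[symmetric]
      by (intro prod.cong refl factors; simp)+
    then show "\<bar>pmf (Ber n p) x * pmf (Ber n q) (\<lambda>i. x i \<noteq> D i)
                 - pmf (Ber n q) x * pmf (Ber n p) (\<lambda>i. x i \<noteq> D i)\<bar> = M x * \<bar>A x - B x\<bar>"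
      using M_nonneg[of x] by (simp add: abs_mult flip: right_diff_distrib)
  qed
  moreover have "mass = pmf (Ber n (lam p q)) D"
    unfolding mass_def pmf_Ber[OF D]
  proof (intro prod.cong refl)
    fix i assume "i \<in> {..<n}"
    then have i: "i < n" by simp
    show "m i True + m i False = ?b (lam p q i) (D i)"
      using lam_bounds[OF i] pq[OF i] by (cases "D i") (simp_all add: m_def, simp add: lam_def algebra_simps)
  qed
  moreover have "s = G n p q D"
    unfolding s_def G_def by (intro sum.cong) (auto simp: a_def)
  ultimately show "S \<le> 2 * pmf (Ber n (lam p q)) D * min 1 (sqrt (G n p q D))"
    and "2 / 13 * pmf (Ber n (lam p q)) D * min 1 (sqrt (G n p q D)) \<le> S"
    using sum_abs_diff_le sum_abs_diff_ge by simp_all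
qed

theorem theorem1:
  "\<exists>c::real. c > 0 \<and>
     (\<forall>(n::nat) (p::nat \<Rightarrow> real) (q::nat \<Rightarrow> real).
        n \<ge> 1 \<longrightarrow> (\<forall>i<n. p i \<in> {0..1} \<and> q i \<in> {0..1}) \<longrightarrow>
          c * E_min_sqrt_G n p q \<le> tv_dist (cube n) (Ber n p) (Ber n q) \<and>
          tv_dist (cube n) (Ber n p) (Ber n q) \<le> E_min_sqrt_G n p q)"
proof (intro exI[of _ "1 / 26"] conjI allI impI)
  fix n :: nat and p q :: "nat \<Rightarrow> real"
  assume "\<forall>i<n. p i \<in> {0..1} \<and> q i \<in> {0..1}"
  then have pq: "p i \<in> {0..1} \<and> q i \<in> {0..1}" if "i < n" for i using that by blast
  define P Q where "P = pmf (Ber n p)" and "Q = pmf (Ber n q)"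
  have xor: "(\<Sum>x\<in>cube n. \<Sum>y\<in>cube n. \<bar>P x * Q y - Q x * P y\<bar>) =
      (\<Sum>D\<in>cube n. \<Sum>x\<in>cube n. \<bar>P x * Q (\<lambda>i. x i \<noteq> D i) - Q x * P (\<lambda>i. x i \<noteq> D i)\<bar>)"
    by (subst (2) sum.swap) (intro sum.cong refl sum_cube_xor)
  have "(\<Sum>x\<in>cube n. \<Sum>y\<in>cube n. \<bar>P x * Q y - Q x * P y\<bar>) \<le> 2 * E_min_sqrt_G n p q"
    unfolding xor unfolding E_min_sqrt_G_eq_sum sum_distrib_left P_def Q_def
    using sum_xor_bounds(1)[of n p q, OF pq] by (intro sum_mono) (simp add: mult.assoc)
  then show "tv_dist (cube n) (Ber n p) (Ber n q) \<le> E_min_sqrt_G n p q"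
    using tv_dist_le_swapped[OF sum_pmf_Ber sum_pmf_Ber, of n p q] by (simp add: P_def Q_def)
  \<comment> \<open>Together with the factor 4 in \<open>swapped_le_tv_dist\<close>, the constant
    2/13 yields 1/26.\<close>
  have "2 / 13 * E_min_sqrt_G n p q \<le> (\<Sum>x\<in>cube n. \<Sum>y\<in>cube n. \<bar>P x * Q y - Q x * P y\<bar>)"
    unfolding xor unfolding E_min_sqrt_G_eq_sum sum_distrib_left P_def Q_def
    using sum_xor_bounds(2)[of n p q, OF pq] by (intro sum_mono) (simp add: mult.assoc)
  then show "1 / 26 * E_min_sqrt_G n p q \<le> tv_dist (cube n) (Ber n p) (Ber n q)"
    using swapped_le_tv_dist[OF sum_pmf_Ber sum_pmf_Ber, of n p q] by (simp add: P_def Q_def)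
qed simp

end
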